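(* Let $X$ be a finite set with $|X|=n\ge2$. Then the number of isomorphism classes of indecomposable left non-degenerate solutions on $X$ is equal to the Harary number $\mathfrak{c}(n)$. Furthermore, up to isomorphism, there is only one right non-degenerate indecomposable solution on $X$, namely the solution $R_f(x,y)=(y,f(x))$ associated to a cycle $f:X\to X$ of length $n$.
   Context: For a set $X$ let $\tau_X(x,y)=(y,x)$ be the flip map on $X\times X$. For a map $R:X\times X\to X\times X$ put, as maps $X^3\to X^3$, $R^{12}=R\times \mathrm{Id}_X$, $R^{23}=\mathrm{Id}_X\times R$, $R^{13}=(\mathrm{Id}_X\times\tau_X)\circ R^{12}\circ(\mathrm{Id}_X\times\tau_X)$. $R$ is called a solution on $X$ (of the set-theoretic Frobenius-Separability equation) if $R^{12}R^{23}=R^{23}R^{13}=R^{13}R^{12}$. An isomorphism of solutions $(X,R)\to(X',R')$ is a bijection $\sigma:X\to X'$ with $(\sigma\times\sigma)\circ R=R'\circ(\sigma\times\sigma)$. Writing $R(x,y)=(l_x(y),r_y(x))$, $R$ is left (resp. right) non-degenerate if $l_x:X\to X$ (resp. $r_x:X\to X$) is bijective for every $x\in X$. A solution $R$ on $X$ is decomposable if there is a partition $X=Y\sqcup Z$ with $Y,Z$ non-empty, $R(Y\times Y)\subseteq Y\times Y$ and $R(Z\times Z)\subseteq Z\times Z$; it is indecomposable otherwise. A self-map $f:X\to X$ is connected if for all $x,y\in X$ there are non-negative integers $m,k$ with $f^m(x)=f^k(y)$. The Harary number $\mathfrak{c}(n)$ is the number of conjugacy classes (under $f\mapsto\sigma\circ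 f\circ\sigma^{-1}$, $\sigma\in S_n$) of connected self-maps $f:\{1,\dots,n\}\to\{1,\dots,n\}$. *)

theory Defs
  imports "HOL-Library.FuncSet" "HOL-Combinatorics.Cycles"
begin

text \<open>
  A map between carrier sets is an extensional function (\<open>undefined\<close> outside its domain), so that
  sets of maps on a finite set are finite and counting isomorphism classes is meaningful.
  The cube of X is the set X \<times> X \<times> X of right-nested triples.
\<close>

definition R12 :: "('a \<times> 'a \<Rightarrow> 'a \<times> 'a) \<Rightarrow> 'a \<times> 'a \<times> 'a \<Rightarrow> 'a \<times> 'a \<times> 'a" where
  "R12 R = (\<lambda>(x, y, z). (fst (R (x, y)), snd (R (x, y)), z))"

definition R23 :: "('a \<times> 'a \<Rightarrow> 'a \<times> 'a) \<Rightarrow> 'a \<times> 'a \<times> 'a \<Rightarrow> 'a \<times> 'a \<times> 'a" where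
  "R23 R = map_prod id R"

definition R13 :: "('a \<times> 'a \<Rightarrow> 'a \<times> 'a) \<Rightarrow> 'a \<times> 'a \<times> 'a \<Rightarrow> 'a \<times> 'a \<times> 'a" where
  "R13 R = map_prod id prod.swap \<circ> R12 R \<circ> map_prod id prod.swap"

definition fs_solution :: "'a set \<Rightarrow> ('a \<times> 'a \<Rightarrow> 'a \<times> 'a) \<Rightarrow> bool" where
  "fs_solution X R \<longleftrightarrow>
     R \<in> X \<times> X \<rightarrow>\<^sub>E X \<times> X \<and>
     (\<forall>t \<in> X \<times> X \<times> X.
        (R12 R \<circ> R23 R) t = (R23 R \<circ> R13 R) t \<and>
        (R23 R \<circ> R13 R) t = (R13 R \<circ> R12 R) t)"

definition solution_iso ::
  "'a set \<Rightarrow> ('a \<times> 'a \<Rightarrow> 'a \<times> 'a) \<Rightarrow> 'b set \<Rightarrow> ('b \<times> 'b \<Rightarrow> 'b \<times> 'b) \<Rightarrow> ('a \<Rightarrow> 'b) \<Rightarrow> bool" where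
  "solution_iso X R X' R' \<sigma> \<longleftrightarrow>
     bij_betw \<sigma> X X' \<and>
     (\<forall>p \<in> X \<times> X. (map_prod \<sigma> \<sigma> \<circ> R) p = (R' \<circ> map_prod \<sigma> \<sigma>) p)"

definition solution_iso_rel ::
  "'a set \<Rightarrow> (('a \<times> 'a \<Rightarrow> 'a \<times> 'a) \<times> ('a \<times> 'a \<Rightarrow> 'a \<times> 'a)) set" where
  "solution_iso_rel X =
     {(R, R'). fs_solution X R \<and> fs_solution X R' \<and> (\<exists>\<sigma>. solution_iso X R X R' \<sigma>)}"

text \<open>The components of \<open>R (x, y) = (lmap R x y, rmap R y x)\<close>.\<close>

definition lmap :: "('a \<times> 'a \<Rightarrow> 'a \<times> 'a) \<Rightarrow> 'a \<Rightarrow> 'a \<Rightarrow> 'a" where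
  "lmap R x = (\<lambda>y. fst (R (x, y)))"

definition rmap :: "('a \<times> 'a \<Rightarrow> 'a \<times> 'a) \<Rightarrow> 'a \<Rightarrow> 'a \<Rightarrow> 'a" where
  "rmap R y = (\<lambda>x. snd (R (x, y)))"

definition left_nondegenerate :: "'a set \<Rightarrow> ('a \<times> 'a \<Rightarrow> 'a \<times> 'a) \<Rightarrow> bool" where
  "left_nondegenerate X R \<longleftrightarrow> (\<forall>x \<in> X. bij_betw (lmap R x) X X)"

definition right_nondegenerate :: "'a set \<Rightarrow> ('a \<times> 'a \<Rightarrow> 'a \<times> 'a) \<Rightarrow> bool" where
  "right_nondegenerate X R \<longleftrightarrow> (\<forall>x \<in> X. bij_betw (rmap R x) X X)"

definition decomposable :: "'a set \<Rightarrow> ('a \<times> 'a \<Rightarrow> 'a \<times> 'a) \<Rightarrow> bool" where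
  "decomposable X R \<longleftrightarrow>
     (\<exists>Y Z. X = Y \<union> Z \<and> Y \<inter> Z = {} \<and> Y \<noteq> {} \<and> Z \<noteq> {} \<and>
        R ` (Y \<times> Y) \<subseteq> Y \<times> Y \<and> R ` (Z \<times> Z) \<subseteq> Z \<times> Z)"

definition connected_map :: "'a set \<Rightarrow> ('a \<Rightarrow> 'a) \<Rightarrow> bool" where
  "connected_map X f \<longleftrightarrow>
     f \<in> X \<rightarrow>\<^sub>E X \<and> (\<forall>x \<in> X. \<forall>y \<in> X. \<exists>m k. (f ^^ m) x = (f ^^ k) y)"

definition conjugacy_rel :: "'a set \<Rightarrow> (('a \<Rightarrow> 'a) \<times> ('a \<Rightarrow> 'a)) set" where
  "conjugacy_rel X =
     {(f, g). f \<in> X \<rightarrow>\<^sub>E X \<and> g \<in> X \<rightarrow>\<^sub>E X \<and>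
        (\<exists>\<sigma>. \<sigma> permutes X \<and> g = restrict (\<sigma> \<circ> f \<circ> inv \<sigma>) X)}"

definition harary :: "nat \<Rightarrow> nat" where
  "harary n = card ({f. connected_map {1..n} f} // conjugacy_rel {1..n})"

definition map_solution :: "'a set \<Rightarrow> ('a \<Rightarrow> 'a) \<Rightarrow> 'a \<times> 'a \<Rightarrow> 'a \<times> 'a" where
  "map_solution X f = restrict (\<lambda>(x, y). (y, f x)) (X \<times> X)"

definition cycle_map :: "nat \<Rightarrow> 'a set \<Rightarrow> ('a \<Rightarrow> 'a) \<Rightarrow> bool" where
  "cycle_map n X f \<longleftrightarrow>
     (\<exists>cs. distinct cs \<and> length cs = n \<and> set cs \<subseteq> X \<and> f = restrict (cycle_of_list cs) X)"

end

theory Submission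
  imports Defs "HOL-Combinatorics.Orbits"
begin

text \<open>
  Write \<open>R (x, y) = (l\<^sub>x y, r\<^sub>y x)\<close>. In coordinates the equation for \<open>R\<close> contains
  \<open>l\<^sub>x (l\<^sub>y z) = l\<^sub>x z\<close> and \<open>r\<^sub>z (l\<^sub>x y) = r\<^sub>z y\<close>. Injectivity of all \<open>l\<^sub>x\<close>, or of all
  \<open>r\<^sub>z\<close>, therefore forces every \<open>l\<^sub>x\<close> to be the identity, and then the equation
  \<open>r\<^bsub>l\<^sub>y z\<^esub> x = r\<^sub>y x\<close> says that \<open>r\<^sub>y\<close> does not depend on \<open>y\<close>. So left
  non-degenerate and right non-degenerate solutions are both of the form
  \<open>R\<^sub>f (x, y) = (y, f x)\<close>; conversely every self-map \<open>f\<close> gives a left non-degenerate solution,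
  which is right non-degenerate exactly when \<open>f\<close> is bijective
  (\<open>left_nondegenerate_solution\<close>, \<open>right_nondegenerate_solution\<close>).

  Under \<open>f \<mapsto> R\<^sub>f\<close> isomorphism of solutions becomes conjugacy of self-maps, and
  indecomposability becomes connectedness, because two points without a common iterate
  are separated by an \<open>f\<close>-stable bipartition (\<open>decomposable_map_solution_iff\<close>). Hence the
  isomorphism classes of left non-degenerate indecomposable solutions correspond to the conjugacy
  classes of connected self-maps of \<open>X\<close>, which a bijection from \<open>X\<close> to \<open>{1..n}\<close> transports to
  those counted by the Harary number.

  In the right non-degenerate case \<open>f\<close> is a connected permutation of a finite set, hence has a
  single orbit, and two permutations with a single orbit of the same size are conjugate by
  matching iterates of chosen base points (\<open>cyclic_on_intertwines\<close>).
\<close>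

section \<open>Intertwining bijections\<close>

definition intertwines :: "'a set \<Rightarrow> ('a \<Rightarrow> 'a) \<Rightarrow> 'b set \<Rightarrow> ('b \<Rightarrow> 'b) \<Rightarrow> ('a \<Rightarrow> 'b) \<Rightarrow> bool" where
  "intertwines X f Y g \<sigma> \<longleftrightarrow> bij_betw \<sigma> X Y \<and> (\<forall>x \<in> X. \<sigma> (f x) = g (\<sigma> x))"

lemma intertwines_id: "intertwines X f X f id"
  by (simp add: intertwines_def)

lemma intertwines_comp:
  assumes "intertwines X f Y g \<sigma>" "intertwines Y g Z h \<tau>"
  shows "intertwines X f Z h (\<tau> \<circ> \<sigma>)"
  using assms by (auto simp: intertwines_def bij_betw_apply intro: bij_betw_trans)

lemma intertwines_inv_into:
  assumes "intertwines X f Y g \<sigma>" and "f \<in> X \<rightarrow> X"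
  shows "intertwines Y g X f (inv_into X \<sigma>)"
proof -
  have bij: "bij_betw \<sigma> X Y" and eq: "\<And>x. x \<in> X \<Longrightarrow> \<sigma> (f x) = g (\<sigma> x)"
    using assms(1) by (auto simp: intertwines_def)
  have "inv_into X \<sigma> (g y) = f (inv_into X \<sigma> y)" if "y \<in> Y" for y
  proof -
    define x where "x = inv_into X \<sigma> y"
    have x: "x \<in> X" "\<sigma> x = y"
      using bij that by (auto simp: x_def bij_betw_def inv_into_into f_inv_into_f)
    then have "f x \<in> X" "g y = \<sigma> (f x)"
      using assms(2) eq by auto
    then show ?thesis
      using bij by (simp add: x_def[symmetric] bij_betw_inv_into_left)
  qed
  then show ?thesis
    using bij by (simp add: intertwines_def bij_betw_inv_into)
qed

lemma intertwines_funpow: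
  assumes "intertwines X f Y g \<sigma>" and "f \<in> X \<rightarrow> X" and "x \<in> X"
  shows "\<sigma> ((f ^^ m) x) = (g ^^ m) (\<sigma> x)"
proof -
  have "\<sigma> ((f ^^ m) x) = (g ^^ m) (\<sigma> x) \<and> (f ^^ m) x \<in> X"
    using assms by (induction m) (auto simp: intertwines_def)
  then show ?thesis ..
qed

lemma connected_map_intertwines:
  assumes \<sigma>: "intertwines X f Y g \<sigma>" and f: "connected_map X f" and g: "g \<in> Y \<rightarrow>\<^sub>E Y"
  shows "connected_map Y g"
proof -
  have fX: "f \<in> X \<rightarrow> X" using f by (auto simp: connected_map_def)
  have "\<exists>m k. (g ^^ m) y = (g ^^ k) z" if yz: "y \<in> Y" "z \<in> Y" for y z
  proof -
    have "Y = \<sigma> ` X" using \<sigma> by (simp add: intertwines_def bij_betw_def)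
    then obtain u v where uv: "u \<in> X" "v \<in> X" "\<sigma> u = y" "\<sigma> v = z"
      using yz by blast
    then obtain m k where "(f ^^ m) u = (f ^^ k) v"
      using f by (meson connected_map_def)
    then show ?thesis
      using intertwines_funpow[OF \<sigma> fX] uv by metis
  qed
  then show ?thesis using g by (simp add: connected_map_def)
qed

text \<open>
  Conjugating permutations are maps on the whole type, whereas an intertwining bijection matters
  only on \<open>X\<close>; extending the latter by the identity outside \<open>X\<close> gives the former. In this form
  conjugacy composes with changes of the underlying set.
\<close>

lemma conjugacy_rel_iff:
  "(f, g) \<in> conjugacy_rel X \<longleftrightarrow>
     f \<in> X \<rightarrow>\<^sub>E X \<and> g \<in> X \<rightarrow>\<^sub>E X \<and> (\<exists>\<sigma>. intertwines X f X g \<sigma>)"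
proof (intro iffI; (elim conjE exE)?)
  assume "(f, g) \<in> conjugacy_rel X"
  then obtain \<sigma> where fg: "f \<in> X \<rightarrow>\<^sub>E X" "g \<in> X \<rightarrow>\<^sub>E X" and \<sigma>: "\<sigma> permutes X"
    and g: "g = restrict (\<sigma> \<circ> f \<circ> inv \<sigma>) X"
    unfolding conjugacy_rel_def by blast
  have "intertwines X f X g \<sigma>"
    using \<sigma> by (simp add: intertwines_def permutes_imp_bij g permutes_in_image permutes_inverses)
  then show "f \<in> X \<rightarrow>\<^sub>E X \<and> g \<in> X \<rightarrow>\<^sub>E X \<and> (\<exists>\<sigma>. intertwines X f X g \<sigma>)"
    using fg by blast
next
  fix \<sigma> assume fg: "f \<in> X \<rightarrow>\<^sub>E X" "g \<in> X \<rightarrow>\<^sub>E X" and \<sigma>: "intertwines X f X g \<sigma>"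
  define \<pi> where "\<pi> = restrict_id \<sigma> X"
  have \<pi>: "\<pi> permutes X"
    unfolding \<pi>_def using \<sigma> by (intro permutes_restrict_id) (simp add: intertwines_def)
  have "g = restrict (\<pi> \<circ> f \<circ> inv \<pi>) X"
  proof (rule extensionalityI[of _ X])
    fix y assume y: "y \<in> X"
    define x where "x = inv \<pi> y"
    have "x \<in> X" using \<pi> y unfolding x_def by (metis permutes_in_image permutes_inv)
    moreover have y_eq: "y = \<pi> x" unfolding x_def using \<pi> by (simp add: permutes_inverses)
    ultimately have "g y = \<sigma> (f x)" and "f x \<in> X"
      using \<sigma> fg by (auto simp: intertwines_def \<pi>_def)
    then show "g y = restrict (\<pi> \<circ> f \<circ> inv \<pi>) X y"
      using y unfolding x_def by (simp add: \<pi>_def)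
  qed (use fg in \<open>auto simp: PiE_def\<close>)
  then show "(f, g) \<in> conjugacy_rel X"
    unfolding conjugacy_rel_def using fg \<pi> by blast
qed

lemma equiv_conjugacy_rel: "equiv (X \<rightarrow>\<^sub>E X) (conjugacy_rel X)"
proof (rule equivI)
  show "conjugacy_rel X \<subseteq> (X \<rightarrow>\<^sub>E X) \<times> (X \<rightarrow>\<^sub>E X)"
    by (auto simp only: conjugacy_rel_iff subrelI mem_Sigma_iff)
  show "refl_on (X \<rightarrow>\<^sub>E X) (conjugacy_rel X)"
    by (rule refl_onI) (use intertwines_id in \<open>auto simp: conjugacy_rel_iff\<close>)
  show "sym (conjugacy_rel X)"
    by (rule symI) (use intertwines_inv_into in \<open>fastforce simp: conjugacy_rel_iff\<close>)
  show "trans (conjugacy_rel X)"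
    by (rule transI) (use intertwines_comp in \<open>fastforce simp: conjugacy_rel_iff\<close>)
qed

section \<open>Counting classes\<close>

text \<open>
  The map \<open>\<phi>\<close> is injective on classes by \<open>rel\<close> and surjective on classes by \<open>surj\<close>. The two
  relations live on larger sets \<open>A'\<close> and \<open>B'\<close>, so that the sets being counted need not be known
  to be unions of classes.
\<close>

lemma card_quotient_eq:
  assumes r: "equiv A' r" "A \<subseteq> A'" and s: "equiv B' s" "B \<subseteq> B'"
    and \<phi>: "\<And>a. a \<in> A \<Longrightarrow> \<phi> a \<in> B"
    and rel: "\<And>a a'. a \<in> A \<Longrightarrow> a' \<in> A \<Longrightarrow> (a, a') \<in> r \<longleftrightarrow> (\<phi> a, \<phi> a') \<in> s"
    and surj: "\<And>b. b \<in> B \<Longrightarrow> \<exists>a \<in> A. (\<phi> a, b) \<in> s"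
  shows "card (A // r) = card (B // s)"
proof -
  have eq: "r `` {a} = r `` {a'} \<longleftrightarrow> s `` {\<phi> a} = s `` {\<phi> a'}" if "a \<in> A" "a' \<in> A" for a a'
    using eq_equiv_class_iff[OF r(1)] eq_equiv_class_iff[OF s(1)] rel[OF that] \<phi> r(2) s(2) that
    by (metis subsetD)
  \<comment> \<open>The induced map on classes, defined through a chosen representative in \<open>A\<close>.\<close>
  define h where "h = (\<lambda>C. s `` {\<phi> (SOME a. a \<in> A \<and> r `` {a} = C)})"
  have h: "h (r `` {a}) = s `` {\<phi> a}" if "a \<in> A" for a
  proof -
    have "(SOME a'. a' \<in> A \<and> r `` {a'} = r `` {a}) \<in> A \<and>
        r `` {SOME a'. a' \<in> A \<and> r `` {a'} = r `` {a}} = r `` {a}"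
      by (rule someI[of "\<lambda>a'. a' \<in> A \<and> r `` {a'} = r `` {a}" a]) (simp add: that)
    then show ?thesis unfolding h_def using eq that by metis
  qed
  have "inj_on h (A // r)"
    by (rule inj_onI) (metis h eq quotientE)
  moreover have "h ` (A // r) = B // s"
  proof (intro equalityI subsetI)
    fix D assume "D \<in> h ` (A // r)"
    then show "D \<in> B // s" by (auto elim!: quotientE simp: h intro!: quotientI \<phi>)
  next
    fix D assume "D \<in> B // s"
    then obtain b where b: "b \<in> B" "D = s `` {b}" by (auto elim: quotientE)
    then obtain a where "a \<in> A" "(\<phi> a, b) \<in> s" using surj by blast
    then have "D = h (r `` {a})" using b h equiv_class_eq[OF s(1)] by simp
    then show "D \<in> h ` (A // r)" using \<open>a \<in> A\<close> by (auto intro: quotientI)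
  qed
  ultimately show ?thesis by (metis card_image)
qed

text \<open>Connectedness and conjugacy are both invariant under relabelling the points of \<open>X\<close>.\<close>

lemma card_connected_maps_eq_harary:
  assumes "finite X" and "card X = n"
  shows "card ({f. connected_map X f} // conjugacy_rel X) = harary n"
proof -
  obtain h where h: "bij_betw h X {1..n}"
    using assms by (metis card_atLeastAtMost diff_Suc_1 finite_atLeastAtMost finite_same_card_bij)
  define \<phi> where "\<phi> f = restrict (h \<circ> f \<circ> inv_into X h) {1..n}" for f
  have in_fun: "\<phi> f \<in> {1..n} \<rightarrow>\<^sub>E {1..n}" if "f \<in> X \<rightarrow>\<^sub>E X" for f
    using h that bij_betw_inv_into[OF h] unfolding \<phi>_def
    by (auto simp del: atLeastAtMost_iff simp: bij_betw_apply PiE_iff)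
  have tw: "intertwines X f {1..n} (\<phi> f) h" if "f \<in> X \<rightarrow>\<^sub>E X" for f
    using h that by (auto simp del: atLeastAtMost_iff simp: intertwines_def \<phi>_def bij_betw_apply bij_betw_inv_into_left)
  show ?thesis unfolding harary_def
  proof (rule card_quotient_eq[OF equiv_conjugacy_rel _ equiv_conjugacy_rel, where \<phi> = \<phi>])
    show "\<phi> f \<in> {f. connected_map {1..n} f}" if "f \<in> {f. connected_map X f}" for f
      using that connected_map_intertwines[OF tw _ in_fun] by (auto simp: connected_map_def)
    show "(f, g) \<in> conjugacy_rel X \<longleftrightarrow> (\<phi> f, \<phi> g) \<in> conjugacy_rel {1..n}"
      if "f \<in> {f. connected_map X f}" "g \<in> {f. connected_map X f}" for f g
    proof -
      have fg: "f \<in> X \<rightarrow>\<^sub>E X" "g \<in> X \<rightarrow>\<^sub>E X" using that by (auto simp: connected_map_def)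
      have inv: "intertwines {1..n} (\<phi> k) X k (inv_into X h)" if "k \<in> X \<rightarrow>\<^sub>E X" for k
        using intertwines_inv_into[OF tw] that by auto
      have "(\<exists>\<sigma>. intertwines X f X g \<sigma>) \<longleftrightarrow> (\<exists>\<sigma>. intertwines {1..n} (\<phi> f) {1..n} (\<phi> g) \<sigma>)"
        using intertwines_comp[OF intertwines_comp[OF inv[OF fg(1)]] tw[OF fg(2)]]
          intertwines_comp[OF intertwines_comp[OF tw[OF fg(1)]] inv[OF fg(2)]] by blast
      then show ?thesis using fg in_fun by (simp add: conjugacy_rel_iff)
    qed
    show "\<exists>f \<in> {f. connected_map X f}. (\<phi> f, g) \<in> conjugacy_rel {1..n}"
      if "g \<in> {f. connected_map {1..n} f}" for g
    proof -
      define f where "f = restrict (inv_into X h \<circ> g \<circ> h) X"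
      have g: "connected_map {1..n} g" "g \<in> {1..n} \<rightarrow>\<^sub>E {1..n}"
        using that by (auto simp: connected_map_def)
      have f: "f \<in> X \<rightarrow>\<^sub>E X"
        using h g(2) bij_betw_inv_into[OF h] unfolding f_def
        by (auto simp del: atLeastAtMost_iff simp: bij_betw_apply PiE_iff)
      have hf: "intertwines X f {1..n} g h"
        using h g(2) by (auto simp del: atLeastAtMost_iff
            simp: intertwines_def f_def bij_betw_apply bij_betw_inv_into_right PiE_iff)
      have inv: "intertwines {1..n} (\<phi> f) X f (inv_into X h)" 
        using intertwines_inv_into[OF tw] f by auto
      have "connected_map X f"
        using connected_map_intertwines[OF intertwines_inv_into[OF hf] g(1) f] f by auto
      moreover have "(\<phi> f, g) \<in> conjugacy_rel {1..n}"
        using in_fun[OF f] g(2) intertwines_comp[OF inv hf] by (auto simp only: conjugacy_rel_iff)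
      ultimately show ?thesis by blast
    qed
  qed (simp_all add: connected_map_def Collect_mono_iff subset_iff del: atLeastAtMost_iff)
qed

section \<open>Non-degenerate solutions come from self-maps\<close>

text \<open>
  Comparing the three composites coordinatewise gives two equations for each coordinate.
\<close>

lemma fs_solution_iff:
  "fs_solution X R \<longleftrightarrow> R \<in> X \<times> X \<rightarrow>\<^sub>E X \<times> X \<and>
     (\<forall>x\<in>X. \<forall>y\<in>X. \<forall>z\<in>X.
        lmap R x (lmap R y z) = lmap R x z \<and> lmap R (lmap R x y) z = lmap R x z \<and>
        rmap R (lmap R y z) x = rmap R y x \<and> lmap R y (rmap R z x) = rmap R y x \<and>
        rmap R (rmap R z x) y = rmap R z y \<and> rmap R z (lmap R x y) = rmap R z y)"
proof -
  have E: "(R12 R \<circ> R23 R) (x, y, z) = (lmap R x (lmap R y z), rmap R (lmap R y z) x, rmap R z y)"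
    "(R23 R \<circ> R13 R) (x, y, z) = (lmap R x z, lmap R y (rmap R z x), rmap R (rmap R z x) y)"
    "(R13 R \<circ> R12 R) (x, y, z) = (lmap R (lmap R x y) z, rmap R y x, rmap R z (lmap R x y))"
    for x y z
    by (simp_all add: R12_def R23_def R13_def lmap_def rmap_def split_beta)
  have triples: "(a1, a2, a3) = (b1, b2, b3) \<and> (b1, b2, b3) = (c1, c2, c3) \<longleftrightarrow>
      a1 = b1 \<and> c1 = b1 \<and> a2 = c2 \<and> b2 = c2 \<and> b3 = a3 \<and> c3 = a3" for a1 a2 a3 b1 b2 b3 c1 c2 c3 :: 'a
    by auto
  show ?thesis
    unfolding fs_solution_def split_paired_Ball_Sigma E triples ..
qed

text \<open>
  When all \<open>l\<^sub>x\<close> are the identity, \<open>r\<^bsub>l\<^sub>y z\<^esub> x = r\<^sub>y x\<close> reads \<open>r\<^sub>z x = r\<^sub>y x\<close>. Any index can then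
  be used to define \<open>f\<close>; the diagonal choice \<open>r\<^sub>x x\<close> avoids fixing a base point.
\<close>

lemma solution_eq_map_solution:
  assumes R: "fs_solution X R" and l: "\<And>x y. x \<in> X \<Longrightarrow> y \<in> X \<Longrightarrow> lmap R x y = y"
  shows "\<exists>f \<in> X \<rightarrow>\<^sub>E X. R = map_solution X f"
proof
  let ?f = "\<lambda>x\<in>X. rmap R x x"
  have RX: "R \<in> X \<times> X \<rightarrow>\<^sub>E X \<times> X" using R by (simp add: fs_solution_def)
  have r: "rmap R z x = rmap R y x" if "x \<in> X" "y \<in> X" "z \<in> X" for x y z
    using R that l by (metis fs_solution_iff)
  show "?f \<in> X \<rightarrow>\<^sub>E X" 
  proof (rule restrict_PiE_iff[THEN iffD2], rule ballI)
    fix x assume "x \<in> X"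
    then have "R (x, x) \<in> X \<times> X" using RX by blast
    then show "rmap R x x \<in> X" by (auto simp: rmap_def)
  qed
  show "R = map_solution X ?f"
  proof (rule extensionalityI[of _ "X \<times> X"])
    fix p assume "p \<in> X \<times> X"
    then obtain x y where p: "p = (x, y)" "x \<in> X" "y \<in> X" by auto
    have "R (x, y) = (lmap R x y, rmap R y x)" by (simp add: lmap_def rmap_def)
    also have "\<dots> = (y, rmap R x x)" using p l[of x y] r[of x x y] by simp
    finally show "R p = map_solution X ?f p" using p by (simp add: map_solution_def)
  qed (use RX in \<open>auto simp: map_solution_def PiE_def\<close>)
qed

text \<open>The coordinate equation \<open>l\<^sub>x (l\<^sub>x y) = l\<^sub>x y\<close> can be cancelled when \<open>l\<^sub>x\<close> is injective.\<close>

lemma left_nondegenerate_solution: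
  assumes R: "fs_solution X R" and "left_nondegenerate X R"
  shows "\<exists>f \<in> X \<rightarrow>\<^sub>E X. R = map_solution X f"
proof (rule solution_eq_map_solution[OF R])
  fix x y assume xy: "x \<in> X" "y \<in> X"
  have inj: "inj_on (lmap R x) X" and X: "lmap R x y \<in> X"
    using assms(2) xy by (auto simp: left_nondegenerate_def bij_betw_def)
  have "lmap R x (lmap R x y) = lmap R x y" using R xy by (simp add: fs_solution_iff)
  then show "lmap R x y = y" using inj X xy(2) by (simp add: inj_on_eq_iff)
qed

text \<open>
  The equation \<open>r\<^sub>z (l\<^sub>x y) = r\<^sub>z y\<close> can be cancelled when \<open>r\<^sub>z\<close> is injective, so right
  non-degeneracy implies left non-degeneracy.
\<close>

lemma right_nondegenerate_solution:
  assumes R: "fs_solution X R" and "right_nondegenerate X R"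
  shows "\<exists>f \<in> X \<rightarrow>\<^sub>E X. R = map_solution X f"
proof (rule solution_eq_map_solution[OF R])
  fix x y assume xy: "x \<in> X" "y \<in> X"
  have "R (x, y) \<in> X \<times> X" using R xy by (auto simp: fs_solution_def)
  then have X: "lmap R x y \<in> X" by (auto simp: lmap_def)
  have inj: "inj_on (rmap R y) X"
    using assms(2) xy by (auto simp: right_nondegenerate_def bij_betw_def)
  have "rmap R y (lmap R x y) = rmap R y y" using R xy by (simp add: fs_solution_iff)
  then show "lmap R x y = y" using inj X xy(2) by (simp add: inj_on_eq_iff)
qed

lemma map_solution_apply [simp]:
  "x \<in> X \<Longrightarrow> y \<in> X \<Longrightarrow> map_solution X f (x, y) = (y, f x)"
  by (simp add: map_solution_def)

lemma fs_solution_map_solution: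
  assumes "f \<in> X \<rightarrow> X"
  shows "fs_solution X (map_solution X f)"
proof -
  have "map_solution X f \<in> X \<times> X \<rightarrow>\<^sub>E X \<times> X"
    using assms by (auto simp: map_solution_def)
  then show ?thesis
    using assms by (auto simp: fs_solution_iff lmap_def rmap_def Pi_iff)
qed

lemma left_nondegenerate_map_solution: "left_nondegenerate X (map_solution X f)"
proof -
  have "bij_betw (lmap (map_solution X f) x) X X" if "x \<in> X" for x
    using bij_betw_id that by (subst bij_betw_cong[where g = id]) (auto simp: lmap_def)
  then show ?thesis by (simp add: left_nondegenerate_def)
qed

lemma right_nondegenerate_map_solution_iff:
  assumes "X \<noteq> {}"
  shows "right_nondegenerate X (map_solution X f) \<longleftrightarrow> bij_betw f X X"
proof -
  have "bij_betw (rmap (map_solution X f) y) X X \<longleftrightarrow> bij_betw f X X" if "y \<in> X" for y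
    by (rule bij_betw_cong) (simp add: rmap_def that)
  then show ?thesis using assms by (auto simp: right_nondegenerate_def)
qed

lemma map_solution_stable_iff:
  assumes "A \<subseteq> X"
  shows "map_solution X f ` (A \<times> A) \<subseteq> A \<times> A \<longleftrightarrow> f ` A \<subseteq> A"
proof -
  have "map_solution X f (x, y) = (y, f x)" if "x \<in> A" "y \<in> A" for x y
    using that assms by (simp add: subset_iff)
  then have "map_solution X f ` (A \<times> A) \<subseteq> A \<times> A \<longleftrightarrow> (\<forall>x\<in>A. \<forall>y\<in>A. f x \<in> A)"
    by (simp add: image_subset_iff)
  then show ?thesis by blast
qed

text \<open>
  A decomposition of the solution is a partition of \<open>X\<close> into two non-empty \<open>f\<close>-stable parts.
  Points in different parts never have a common iterate; conversely, if \<open>x\<close> and \<open>y\<close> have none, the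
  points that share an iterate with \<open>x\<close> and the remaining points form such a partition.
\<close>

lemma decomposable_map_solution_iff:
  assumes "f \<in> X \<rightarrow>\<^sub>E X"
  shows "\<not> decomposable X (map_solution X f) \<longleftrightarrow> connected_map X f"
proof
  assume indec: "\<not> decomposable X (map_solution X f)"
  have "\<exists>m k. (f ^^ m) y = (f ^^ k) x" if xy: "x \<in> X" "y \<in> X" for x y
  proof (rule ccontr)
    assume neg: "\<not> (\<exists>m k. (f ^^ m) y = (f ^^ k) x)"
    define Y where "Y = {z \<in> X. \<exists>m k. (f ^^ m) z = (f ^^ k) x}"
    have iff: "f z \<in> Y \<longleftrightarrow> z \<in> Y" if "z \<in> X" for z
    proof
      assume "f z \<in> Y"
      then obtain m k where "(f ^^ m) (f z) = (f ^^ k) x" by (auto simp: Y_def)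
      then have "(f ^^ Suc m) z = (f ^^ k) x" by (simp add: funpow_swap1)
      then show "z \<in> Y" using that unfolding Y_def by blast
    next
      assume "z \<in> Y"
      then obtain m k where "(f ^^ m) z = (f ^^ k) x" by (auto simp: Y_def)
      then have "(f ^^ m) (f z) = (f ^^ Suc k) x" by (simp add: funpow_swap1[symmetric])
      then show "f z \<in> Y" using that assms unfolding Y_def by blast
    qed
    have "x \<in> Y" using xy by (auto simp: Y_def)
    moreover have "y \<in> X - Y" using xy neg by (auto simp: Y_def)
    moreover have sub: "Y \<subseteq> X" by (auto simp: Y_def)
    moreover have "f ` Y \<subseteq> Y"
      using sub iff by blast
    moreover have "f ` (X - Y) \<subseteq> X - Y"
      using iff assms by blast
    ultimately have "X = Y \<union> (X - Y) \<and> Y \<inter> (X - Y) = {} \<and> Y \<noteq> {} \<and> X - Y \<noteq> {} \<and>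
        map_solution X f ` (Y \<times> Y) \<subseteq> Y \<times> Y \<and>
        map_solution X f ` ((X - Y) \<times> (X - Y)) \<subseteq> (X - Y) \<times> (X - Y)"
      using map_solution_stable_iff[of Y X f] map_solution_stable_iff[of "X - Y" X f] by blast
    then have "decomposable X (map_solution X f)"
      unfolding decomposable_def by (rule exI[of _ Y, OF exI[of _ "X - Y"]])
    then show False using indec by simp
  qed
  then show "connected_map X f" using assms by (auto simp: connected_map_def)
next
  assume conn: "connected_map X f"
  show "\<not> decomposable X (map_solution X f)"
  proof
    assume "decomposable X (map_solution X f)"
    then obtain Y Z where sets: "X = Y \<union> Z" "Y \<inter> Z = {}" "Y \<noteq> {}" "Z \<noteq> {}"
      and "map_solution X f ` (Y \<times> Y) \<subseteq> Y \<times> Y" "map_solution X f ` (Z \<times> Z) \<subseteq> Z \<times> Z"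
      by (auto simp only: decomposable_def)
    then have Y: "f ` Y \<subseteq> Y" and Z: "f ` Z \<subseteq> Z"
      using map_solution_stable_iff[of Y X f] map_solution_stable_iff[of Z X f] by simp_all
    obtain y z where YZ: "y \<in> Y" "z \<in> Z" using sets by blast
    have stable: "(f ^^ m) x \<in> A" if "f ` A \<subseteq> A" "x \<in> A" for A x m
      using that by (induction m) auto
    obtain m k where "(f ^^ m) y = (f ^^ k) z"
      using conn YZ sets(1) by (meson UnI1 UnI2 connected_map_def)
    then show False using stable[OF Y YZ(1), of m] stable[OF Z YZ(2), of k] sets(2) by auto
  qed
qed

section \<open>Isomorphism of solutions and conjugacy of self-maps\<close>

lemma solution_iso_map_solution_iff:
  assumes "X \<noteq> {}"
  shows "solution_iso X (map_solution X f) Y (map_solution Y g) \<sigma> \<longleftrightarrow> intertwines X f Y g \<sigma>"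
proof (cases "bij_betw \<sigma> X Y")
  case True
  then have "map_prod \<sigma> \<sigma> (map_solution X f (x, y)) = map_solution Y g (map_prod \<sigma> \<sigma> (x, y)) \<longleftrightarrow>
      \<sigma> (f x) = g (\<sigma> x)" if "x \<in> X" "y \<in> X" for x y
    using that by (simp add: bij_betw_apply)
  then have "solution_iso X (map_solution X f) Y (map_solution Y g) \<sigma> \<longleftrightarrow>
      (\<forall>x\<in>X. \<forall>y\<in>X. \<sigma> (f x) = g (\<sigma> x))"
    using True by (simp add: solution_iso_def split_paired_Ball_Sigma)
  then show ?thesis using True assms by (auto simp: intertwines_def)
qed (simp add: solution_iso_def intertwines_def)

lemma solution_iso_inv_into:
  assumes \<sigma>: "solution_iso X R Y S \<sigma>" and "fs_solution X R"
  shows "solution_iso Y S X R (inv_into X \<sigma>)"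
proof -
  have bij: "bij_betw \<sigma> X Y" using \<sigma> by (simp add: solution_iso_def)
  have RX: "R \<in> X \<times> X \<rightarrow> X \<times> X" using assms(2) by (auto simp: fs_solution_def)
  let ?\<tau> = "map_prod (inv_into X \<sigma>) (inv_into X \<sigma>)"
  have "?\<tau> (S q) = R (?\<tau> q)" if "q \<in> Y \<times> Y" for q
  proof -
    have p: "?\<tau> q \<in> X \<times> X" "map_prod \<sigma> \<sigma> (?\<tau> q) = q"
      using that bij bij_betw_inv_into[OF bij]
      by (auto simp: bij_betw_apply bij_betw_inv_into_right)
    then have "map_prod \<sigma> \<sigma> (R (?\<tau> q)) = S q" using \<sigma> by (auto simp: solution_iso_def)
    moreover have "?\<tau> (map_prod \<sigma> \<sigma> u) = u" if "u \<in> X \<times> X" for u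
      using that bij by (auto simp: bij_betw_inv_into_left)
    ultimately show ?thesis using RX p(1) by (metis Pi_mem)
  qed
  then show ?thesis using bij_betw_inv_into[OF bij] by (simp add: solution_iso_def)
qed

lemma equiv_solution_iso_rel: "equiv {R. fs_solution X R} (solution_iso_rel X)"
proof (rule equivI)
  show "refl_on {R. fs_solution X R} (solution_iso_rel X)"
    by (rule refl_onI) (auto simp: solution_iso_rel_def solution_iso_def map_prod.id intro!: exI[of _ id])
  show "sym (solution_iso_rel X)"
    by (rule symI) (use solution_iso_inv_into in \<open>fastforce simp: solution_iso_rel_def\<close>)
  show "trans (solution_iso_rel X)"
  proof (rule transI)
    fix R S T assume RS: "(R, S) \<in> solution_iso_rel X" and ST: "(S, T) \<in> solution_iso_rel X"
    obtain \<sigma> \<tau> where \<sigma>: "solution_iso X R X S \<sigma>" and \<tau>: "solution_iso X S X T \<tau>"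
      using RS ST by (auto simp: solution_iso_rel_def)
    have "solution_iso X R X T (\<tau> \<circ> \<sigma>)"
      using \<sigma> \<tau> by (auto simp: solution_iso_def bij_betw_apply map_prod.comp[symmetric]
          intro: bij_betw_trans)
    then show "(R, T) \<in> solution_iso_rel X" using RS ST by (auto simp: solution_iso_rel_def)
  qed
qed (auto simp: solution_iso_rel_def)

section \<open>Cyclic maps\<close>

text \<open>
  Over a finite set the orbits of a permutation are closed under going backwards. A common iterate
  of \<open>x\<close> and \<open>y\<close> lies in both orbits, so \<open>y\<close> is reached from \<open>x\<close> by first moving to that iterate.
\<close>

lemma connected_bijection_cyclic_on:
  assumes "finite X" "X \<noteq> {}" "bij_betw f X X" "connected_map X f"
  shows "cyclic_on f X"
proof -
  define p where "p = restrict_id f X"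
  have p: "p permutes X" unfolding p_def using assms(3) by (rule permutes_restrict_id)
  then have perm: "permutation p" using assms(1) by (auto simp: permutation_permutes)
  have pf: "p x = f x" if "x \<in> X" for x using that by (simp add: p_def)
  have fp: "(p ^^ m) x = (f ^^ m) x \<and> (f ^^ m) x \<in> X" if "x \<in> X" for m x
    using that assms(3) by (induction m) (auto simp: pf bij_betw_apply)
  obtain x where x: "x \<in> X" using assms(2) by blast
  have "X \<subseteq> orbit p x"
  proof
    fix y assume y: "y \<in> X"
    then obtain m k where "(f ^^ m) y = (f ^^ k) x" using assms(4) x by (meson connected_map_def)
    then have "(p ^^ m) y = (p ^^ k) x" using fp x y by simp
    then have "(p ^^ k) x \<in> orbit p y" by (auto simp: orbit_altdef_permutation[OF perm] dest: sym)
    then have "y \<in> orbit p ((p ^^ k) x)"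
      by (rule orbit_swap[OF permutation_self_in_orbit[OF perm]])
    moreover have "(p ^^ k) x \<in> orbit p x" by (auto simp: orbit_altdef_permutation[OF perm])
    ultimately show "y \<in> orbit p x" by (rule orbit_trans)
  qed
  then have "cyclic_on p X"
    using permutes_orbit_subset[OF p x] x by (auto simp: cyclic_on_def)
  then show ?thesis using cyclic_cong[of X p f] pf by simp
qed

lemma cyclic_on_enumeration:
  assumes "cyclic_on f X" "x \<in> X"
  shows "bij_betw (\<lambda>i. (f ^^ i) x) {0..<card X} X" and "(f ^^ card X) x = x"
proof -
  have X: "orbit f x = X" using assms by (rule orbit_cyclic_eq3)
  then have x: "x \<in> orbit f x" using assms(2) by simp
  have bij: "bij_betw (\<lambda>i. (f ^^ i) x) {0..<funpow_dist1 f x x} X"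
    using inj_on_funpow_dist1[OF x] orbit_conv_funpow_dist1[OF x] X by (simp add: bij_betw_def)
  then have "card X = funpow_dist1 f x x" using bij_betw_same_card by fastforce
  then show "bij_betw (\<lambda>i. (f ^^ i) x) {0..<card X} X" "(f ^^ card X) x = x"
    using bij funpow_dist1_prop[OF x] by simp_all
qed

text \<open>
  The intertwining bijection sends \<open>f\<^sup>i x\<close> to \<open>g\<^sup>i y\<close>. It respects the step from the last
  iterate back to the base point since both orbits close up after the same number of steps.
\<close>

lemma cyclic_on_intertwines:
  assumes f: "cyclic_on f X" and g: "cyclic_on g Y" and card: "card X = card Y"
  shows "\<exists>\<sigma>. intertwines X f Y g \<sigma>"
proof -
  obtain x y where x: "x \<in> X" and y: "y \<in> Y" using f g by (auto simp: cyclic_on_def)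
  note enum_f = cyclic_on_enumeration[OF f x] and enum_g = cyclic_on_enumeration[OF g y]
  define e where "e = inv_into {0..<card X} (\<lambda>i. (f ^^ i) x)"
  define \<sigma> where "\<sigma> = (\<lambda>i. (g ^^ i) y) \<circ> e"
  have bij: "bij_betw \<sigma> X Y"
    unfolding \<sigma>_def e_def
    using bij_betw_inv_into[OF enum_f(1)] enum_g(1) card by (auto intro: bij_betw_trans)
  \<comment> \<open>The case \<open>i = card X\<close> is the wrap-around to the base points.\<close>
  have \<sigma>: "\<sigma> ((f ^^ i) x) = (g ^^ i) y" if "i \<le> card X" for i
  proof (cases "i < card X")
    case True
    then have "e ((f ^^ i) x) = i"
      unfolding e_def using bij_betw_inv_into_left[OF enum_f(1)] by simp
    then show ?thesis by (simp add: \<sigma>_def)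
  next
    case False
    have "card X > 0" using finite_cyclic_on[OF f] x by (auto simp: card_gt_0_iff)
    then have "e x = 0"
      unfolding e_def using bij_betw_inv_into_left[OF enum_f(1), of 0] by simp
    then show ?thesis using False that enum_f(2) enum_g(2) card by (simp add: \<sigma>_def)
  qed
  have "\<sigma> (f u) = g (\<sigma> u)" if u: "u \<in> X" for u
  proof -
    have "u \<in> (\<lambda>i. (f ^^ i) x) ` {0..<card X}"
      using u bij_betw_imp_surj_on[OF enum_f(1)] by simp
    then obtain i where i: "i < card X" "u = (f ^^ i) x"
      by auto
    then show ?thesis using \<sigma>[of i] \<sigma>[of "Suc i"] by simp
  qed
  then show ?thesis using bij by (auto simp: intertwines_def)
qed

text \<open>The list of a full-length cycle exhausts \<open>X\<close>, and its entries are iterates of the first.\<close>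

lemma cycle_map_bij_connected:
  assumes "finite X" and n: "card X = n" and "cycle_map n X f"
  shows "bij_betw f X X" and "connected_map X f"
proof -
  obtain cs where cs: "distinct cs" "length cs = n" "set cs \<subseteq> X"
    and f: "f = restrict (cycle_of_list cs) X"
    using assms(3) by (auto simp: cycle_map_def)
  have X: "set cs = X" using cs n assms(1) by (metis card_subset_eq distinct_card)
  let ?p = "cycle_of_list cs"
  have p: "bij_betw ?p X X" using cycle_permutes[of cs] X by (simp add: permutes_imp_bij)
  show bij: "bij_betw f X X" using p by (simp add: f cong: bij_betw_cong)
  have f_pow: "(f ^^ m) x = (?p ^^ m) x \<and> (f ^^ m) x \<in> X" if "x \<in> X" for m x
    using that p by (induction m) (auto simp: f bij_betw_apply)
  have pow: "(f ^^ i) (cs ! 0) = cs ! i" if "i < n" for i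
  proof -
    have n0: "0 < length cs" using that cs(2) by simp
    have "(?p ^^ i) (cs ! 0) = map (?p ^^ i) cs ! 0" using n0 by simp
    also have "\<dots> = cs ! i"
      unfolding cyclic_rotation[OF cs(1)] using n0 that cs(2) by (simp add: nth_rotate)
    finally show ?thesis using f_pow[of "cs ! 0"] n0 X by (metis nth_mem)
  qed
  have "\<exists>m k. (f ^^ m) x = (f ^^ k) y" if xy: "x \<in> X" "y \<in> X" for x y
  proof -
    obtain i j where "i < n" "x = cs ! i" "j < n" "y = cs ! j"
      using xy X cs(2) by (metis in_set_conv_nth)
    moreover have "(f ^^ j) ((f ^^ i) c) = (f ^^ i) ((f ^^ j) c)" for c
      by (metis add.commute comp_apply funpow_add)
    ultimately have "(f ^^ j) x = (f ^^ i) y"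
      using pow[of i] pow[of j] by metis
    then show ?thesis by blast
  qed
  moreover have "f \<in> X \<rightarrow>\<^sub>E X" using bij by (auto simp: f bij_betw_apply)
  ultimately show "connected_map X f" by (simp add: connected_map_def)
qed

section \<open>The classification\<close>

theorem corollary3p8:
  fixes X :: "'a set" and n :: nat
  assumes "finite X" and "card X = n" and "n \<ge> 2"
  shows "card ({R. fs_solution X R \<and> left_nondegenerate X R \<and> \<not> decomposable X R}
               // solution_iso_rel X) = harary n
    \<and> (\<exists>f. cycle_map n X f)
    \<and> (\<forall>f. cycle_map n X f \<longrightarrow>
          map_solution X f \<in> {R. fs_solution X R \<and> right_nondegenerate X R \<and> \<not> decomposable X R}
          \<and> {R. fs_solution X R \<and> right_nondegenerate X R \<and> \<not> decomposable X R}
              // solution_iso_rel X = {solution_iso_rel X `` {map_solution X f}})"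
proof (intro conjI allI impI)
  let ?L = "{R. fs_solution X R \<and> left_nondegenerate X R \<and> \<not> decomposable X R}"
  let ?R = "{R. fs_solution X R \<and> right_nondegenerate X R \<and> \<not> decomposable X R}"
  have ne: "X \<noteq> {}" using assms by auto
  have iso: "(map_solution X f, map_solution X g) \<in> solution_iso_rel X \<longleftrightarrow>
      (\<exists>\<sigma>. intertwines X f X g \<sigma>)" if "f \<in> X \<rightarrow>\<^sub>E X" "g \<in> X \<rightarrow>\<^sub>E X" for f g
    using that
    by (auto simp: solution_iso_rel_def solution_iso_map_solution_iff[OF ne] PiE_def
        intro!: fs_solution_map_solution)
  have L_iff: "map_solution X f \<in> ?L \<longleftrightarrow> connected_map X f"
    and R_iff: "map_solution X f \<in> ?R \<longleftrightarrow> connected_map X f \<and> bij_betw f X X"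
    if "f \<in> X \<rightarrow>\<^sub>E X" for f
    using decomposable_map_solution_iff[OF that] left_nondegenerate_map_solution[of X f]
      right_nondegenerate_map_solution_iff[OF ne, of f] fs_solution_map_solution[of f X] that
    by auto
  have L: "?L = map_solution X ` {f. connected_map X f}"
  proof (intro equalityI subsetI)
    fix R assume "R \<in> ?L"
    moreover from this obtain f where "f \<in> X \<rightarrow>\<^sub>E X" "R = map_solution X f"
      using left_nondegenerate_solution[of X R] by auto
    ultimately show "R \<in> map_solution X ` {f. connected_map X f}" using L_iff[of f] by simp
  next
    fix R assume "R \<in> map_solution X ` {f. connected_map X f}"
    then obtain f where "R = map_solution X f" "connected_map X f" by (elim imageE) simp
    moreover from this have "f \<in> X \<rightarrow>\<^sub>E X" by (simp add: connected_map_def)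
    ultimately show "R \<in> ?L" using L_iff[of f] by simp
  qed
  have R: "?R = map_solution X ` {f. connected_map X f \<and> bij_betw f X X}"
  proof (intro equalityI subsetI)
    fix R assume "R \<in> ?R"
    moreover from this obtain f where "f \<in> X \<rightarrow>\<^sub>E X" "R = map_solution X f"
      using right_nondegenerate_solution[of X R] by auto
    ultimately show "R \<in> map_solution X ` {f. connected_map X f \<and> bij_betw f X X}"
      using R_iff[of f] by simp
  next
    fix R assume "R \<in> map_solution X ` {f. connected_map X f \<and> bij_betw f X X}"
    then obtain f where "R = map_solution X f" "connected_map X f" "bij_betw f X X"
      by (elim imageE) simp
    moreover from this have "f \<in> X \<rightarrow>\<^sub>E X" by (simp add: connected_map_def)
    ultimately show "R \<in> ?R" using R_iff[of f] by simp
  qed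
  have "card ({f. connected_map X f} // conjugacy_rel X) = card (?L // solution_iso_rel X)"
  proof (rule card_quotient_eq[OF equiv_conjugacy_rel _ equiv_solution_iso_rel])
    show "map_solution X f \<in> ?L" if "f \<in> {f. connected_map X f}" for f
      using that by (auto simp only: L)
    show "(f, g) \<in> conjugacy_rel X \<longleftrightarrow> (map_solution X f, map_solution X g) \<in> solution_iso_rel X"
      if "f \<in> {f. connected_map X f}" "g \<in> {f. connected_map X f}" for f g
      using that by (simp add: conjugacy_rel_iff iso connected_map_def)
    show "\<exists>f \<in> {f. connected_map X f}. (map_solution X f, R) \<in> solution_iso_rel X"
      if "R \<in> ?L" for R
    proof -
      have "(R, R) \<in> solution_iso_rel X"
        using equiv_solution_iso_rel that by (auto simp: equiv_def refl_on_def)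
      then show ?thesis using that unfolding L by blast
    qed
  qed (auto simp: connected_map_def)
  then show "card (?L // solution_iso_rel X) = harary n"
    using card_connected_maps_eq_harary[OF assms(1,2)] by simp
  obtain cs where "set cs = X" "distinct cs" "length cs = n"
    using finite_distinct_list[OF assms(1)] assms(2) distinct_card by metis
  then show "\<exists>f. cycle_map n X f" unfolding cycle_map_def by blast
  fix f assume cyc: "cycle_map n X f"
  note f = cycle_map_bij_connected[OF assms(1,2) cyc]
  show fR: "map_solution X f \<in> ?R" unfolding R using f by blast
  have "solution_iso_rel X `` {S} = solution_iso_rel X `` {map_solution X f}" if S: "S \<in> ?R" for S
  proof -
    obtain g where g: "S = map_solution X g" "connected_map X g" "bij_betw g X X"
      using S unfolding R by blast
    have "\<exists>\<sigma>. intertwines X g X f \<sigma>"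
      using f g assms(1) ne by (intro cyclic_on_intertwines connected_bijection_cyclic_on) auto
    then have "(S, map_solution X f) \<in> solution_iso_rel X"
      using f(2) g by (simp add: iso connected_map_def)
    then show ?thesis by (rule equiv_class_eq[OF equiv_solution_iso_rel])
  qed
  then show "?R // solution_iso_rel X = {solution_iso_rel X `` {map_solution X f}}"
    using fR unfolding quotient_def by blast
qed

end
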